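(* Let $G$ be a finite simple graph without isolated vertices. Then $$\alpha(G)\leq \tau(G)\,[1+\alpha(G)-\sigma_{v}(G)].$$
   Context: A stable (independent) set of $G$ is a set of pairwise nonadjacent vertices; it is maximal if it is maximal with respect to inclusion. $\alpha(G)$ is the stability number of $G$, i.e. the maximum cardinality of a stable set of $G$. A vertex cover of $G$ is a set of vertices meeting every edge; $\tau(G)$ is the minimum cardinality of a vertex cover (so $\alpha(G)+\tau(G)=|V(G)|$). The $\sigma_v$-cover number $\sigma_{v}(G)$ is the maximum natural number $m$ such that every vertex of $G$ belongs to a maximal stable set with at least $m$ vertices. *)

theory Defs
  imports "Graph_Theory.Digraph"
begin

text \<open>
  Finite simple graphs are the members of the locale \<^locale>\<open>graph\<close>: finite, loop-free symmetric
  digraphs without parallel arcs, where an undirected edge is a pair of opposite arcs.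
\<close>

definition isolated_vertex :: "('a, 'b) pre_digraph \<Rightarrow> 'a \<Rightarrow> bool" where
  "isolated_vertex G v \<longleftrightarrow> v \<in> verts G \<and> (\<forall>u \<in> verts G. \<not> (v \<rightarrow>\<^bsub>G\<^esub> u))"

definition stable_set :: "('a, 'b) pre_digraph \<Rightarrow> 'a set \<Rightarrow> bool" where
  "stable_set G S \<longleftrightarrow> S \<subseteq> verts G \<and> (\<forall>u \<in> S. \<forall>v \<in> S. \<not> (u \<rightarrow>\<^bsub>G\<^esub> v))"

definition maximal_stable_set :: "('a, 'b) pre_digraph \<Rightarrow> 'a set \<Rightarrow> bool" where
  "maximal_stable_set G S \<longleftrightarrow>
     stable_set G S \<and> (\<forall>T. stable_set G T \<and> S \<subseteq> T \<longrightarrow> T = S)"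

definition stability_number :: "('a, 'b) pre_digraph \<Rightarrow> nat" where
  "stability_number G = Max {card S | S. stable_set G S}"

definition vertex_cover :: "('a, 'b) pre_digraph \<Rightarrow> 'a set \<Rightarrow> bool" where
  "vertex_cover G C \<longleftrightarrow>
     C \<subseteq> verts G \<and> (\<forall>e \<in> arcs G. tail G e \<in> C \<or> head G e \<in> C)"

definition vertex_cover_number :: "('a, 'b) pre_digraph \<Rightarrow> nat" where
  "vertex_cover_number G = Min {card C | C. vertex_cover G C}"

text \<open>
  If \<open>G\<close> is finite and has a vertex, the set below contains 0 and is bounded by the number of
  vertices.  For the graph without vertices it is all of \<open>\<nat>\<close> and the maximum is unspecified.
\<close>

definition sigma_v :: "('a, 'b) pre_digraph \<Rightarrow> nat" where
  "sigma_v G = Max {m. \<forall>v \<in> verts G. \<exists>S. maximal_stable_set G S \<and> v \<in> S \<and> m \<le> card S}"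

end

theory Submission
  imports Defs
begin

text \<open>
  Let \<open>C\<close> be a minimum vertex cover and \<open>A\<close> its complement, a maximum stable set, and write
  \<open>N D\<close> for the set of neighbours in \<open>A\<close> of \<open>D \<subseteq> C\<close>.  Exchanging \<open>N T\<close> for \<open>T\<close> gives
  \<open>card T \<le> card (N T)\<close> for each stable \<open>T \<subseteq> C\<close>, whereas a stable set \<open>S\<close> with at least
  \<open>\<sigma>\<close> vertices avoids \<open>N (S \<inter> C)\<close>, so that
  \<open>card (N (S \<inter> C)) \<le> card (S \<inter> C) + \<alpha> - \<sigma>\<close>.  Together, adding \<open>S \<inter> C\<close> to a set
  \<open>D \<subseteq> C\<close> increases \<open>N D\<close> by at most \<open>card (S \<inter> C - D) + \<alpha> - \<sigma>\<close> vertices, which is at most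
  \<open>card (S \<inter> C - D) * (1 + \<alpha> - \<sigma>)\<close> if \<open>S\<close> contains a vertex of \<open>C - D\<close>.  Growing \<open>D\<close> from the
  empty set up to \<open>C\<close> yields the bound, because \<open>N C = A\<close> in the absence of isolated vertices.
\<close>

definition nbrs_in :: "('a, 'b) pre_digraph \<Rightarrow> 'a set \<Rightarrow> 'a set \<Rightarrow> 'a set" where
  "nbrs_in G A D = {a \<in> A. \<exists>d \<in> D. d \<rightarrow>\<^bsub>G\<^esub> a}"

lemma nbrs_in_subset: "nbrs_in G A D \<subseteq> A"
  by (auto simp: nbrs_in_def)

lemma nbrs_in_Un: "nbrs_in G A (D \<union> E) = nbrs_in G A D \<union> nbrs_in G A E"
  by (auto simp: nbrs_in_def)

lemma nbrs_in_mono: "D \<subseteq> E \<Longrightarrow> nbrs_in G A D \<subseteq> nbrs_in G A E"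
  by (auto simp: nbrs_in_def)

lemma stable_set_subset: "stable_set G S \<Longrightarrow> T \<subseteq> S \<Longrightarrow> stable_set G T"
  by (auto simp: stable_set_def)

context graph
begin

lemma stable_set_finite: "stable_set G S \<Longrightarrow> finite S"
  by (meson finite_subset finite_verts stable_set_def)

lemma finite_stable_cards: "finite {card S | S. stable_set G S}"
  by (rule finite_subset[of _ "card ` Pow (verts G)"]) (auto simp: stable_set_def)

lemma finite_cover_cards: "finite {card C | C. vertex_cover G C}"
  by (rule finite_subset[of _ "card ` Pow (verts G)"]) (auto simp: vertex_cover_def)

lemma card_le_stability_number: "stable_set G S \<Longrightarrow> card S \<le> stability_number G"
  unfolding stability_number_def by (rule Max_ge[OF finite_stable_cards]) auto

lemma vertex_cover_number_le: "vertex_cover G C \<Longrightarrow> vertex_cover_number G \<le> card C"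
  unfolding vertex_cover_number_def by (rule Min_le[OF finite_cover_cards]) auto

lemma obtain_maximum_stable_set:
  obtains A where "stable_set G A" "card A = stability_number G"
proof -
  have "stable_set G {}"
    by (simp add: stable_set_def)
  then have "{card S | S. stable_set G S} \<noteq> {}"
    by blast
  from Max_in[OF finite_stable_cards this] that show thesis
    unfolding stability_number_def by auto
qed

lemma obtain_minimum_vertex_cover:
  obtains C where "vertex_cover G C" "card C = vertex_cover_number G"
proof -
  have "vertex_cover G (verts G)"
    by (simp add: vertex_cover_def)
  then have "{card C | C. vertex_cover G C} \<noteq> {}"
    by blast
  from Min_in[OF finite_cover_cards this] that show thesis
    unfolding vertex_cover_number_def by auto
qed

lemma stable_set_Compl_cover:
  assumes "vertex_cover G C"
  shows "stable_set G (verts G - C)"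
  using assms by (force simp: stable_set_def vertex_cover_def arcs_ends_def arc_to_ends_def)

lemma vertex_cover_Compl_stable:
  assumes "stable_set G S"
  shows "vertex_cover G (verts G - S)"
  using assms dominatesI
  by (fastforce simp: stable_set_def vertex_cover_def arc_to_ends_def)

text \<open>A stable set larger than the complement of \<open>C\<close> would itself have a
  complement that is a vertex cover smaller than \<open>C\<close>.\<close>

lemma stability_number_Compl_minimum_cover:
  assumes "vertex_cover G C" "card C = vertex_cover_number G"
  shows "card (verts G - C) = stability_number G"
proof (rule antisym)
  show "card (verts G - C) \<le> stability_number G"
    by (rule card_le_stability_number[OF stable_set_Compl_cover[OF assms(1)]])
  obtain S where S: "stable_set G S" "card S = stability_number G"
    by (rule obtain_maximum_stable_set)
  have sub: "S \<subseteq> verts G" "C \<subseteq> verts G"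
    using S assms by (auto simp: stable_set_def vertex_cover_def)
  have "card C \<le> card (verts G - S)"
    using vertex_cover_number_le[OF vertex_cover_Compl_stable[OF S(1)]] assms(2) by simp
  moreover have "card S \<le> card (verts G)" "card C \<le> card (verts G)"
    using sub by (auto intro: card_mono)
  moreover have "card (verts G - S) = card (verts G) - card S"
    "card (verts G - C) = card (verts G) - card C"
    using sub by (auto intro!: card_Diff_subset intro: finite_subset[OF _ finite_verts])
  ultimately show "stability_number G \<le> card (verts G - C)"
    using S(2) by linarith
qed

lemma card_le_nbrs_in_maximum_stable:
  assumes A: "stable_set G A" "card A = stability_number G"
    and T: "stable_set G T" "T \<inter> A = {}"
  shows "card T \<le> card (nbrs_in G A T)"
proof -
  have fin: "finite A" "finite T"
    using A T by (auto intro: stable_set_finite)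
  \<comment> \<open>No arc joins the two parts, since every neighbour of \<open>T\<close> in
    \<open>A\<close> has been removed; symmetry of the arcs covers both directions.\<close>
  have "stable_set G (T \<union> (A - nbrs_in G A T))"
    using A(1) T(1) unfolding stable_set_def nbrs_in_def
    by (blast dest: arcs_ends_symmetric[OF sym_arcs])
  then have "card (T \<union> (A - nbrs_in G A T)) \<le> card A"
    using card_le_stability_number A(2) by simp
  moreover have "card (T \<union> (A - nbrs_in G A T)) = card T + card (A - nbrs_in G A T)"
    using fin T(2) by (intro card_Un_disjoint) auto
  moreover have "card (A - nbrs_in G A T) = card A - card (nbrs_in G A T)"
    "card (nbrs_in G A T) \<le> card A"
    using card_Diff_subset[OF finite_subset[OF nbrs_in_subset fin(1)] nbrs_in_subset]
      card_mono[OF fin(1) nbrs_in_subset]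
    by blast+
  ultimately show ?thesis
    by linarith
qed

lemma card_nbrs_in_stable_le:
  assumes "finite A" "stable_set G S"
  shows "card (nbrs_in G A S) + card (S \<inter> A) \<le> card A"
proof -
  have "nbrs_in G A S \<inter> (S \<inter> A) = {}"
    using assms(2) by (auto simp: stable_set_def nbrs_in_def)
  then have "card (nbrs_in G A S) + card (S \<inter> A) = card (nbrs_in G A S \<union> (S \<inter> A))"
    using assms(1) by (intro card_Un_disjoint[symmetric]) (auto intro: finite_subset[OF nbrs_in_subset])
  also have "\<dots> \<le> card A"
    using assms(1) nbrs_in_subset[of G A S] by (intro card_mono) auto
  finally show ?thesis .
qed

text \<open>Submodularity of the neighbour count, applied to \<open>D\<close> and
  \<open>S - A\<close>: the exchange bound controls their intersection from below, and the vertices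
  of \<open>A\<close> outside \<open>S\<close> control \<open>S - A\<close> from above.\<close>

lemma card_nbrs_in_Un_stable:
  assumes A: "stable_set G A" "card A = stability_number G"
    and S: "stable_set G S" and D: "D \<inter> A = {}" "finite D"
  shows "card (nbrs_in G A (D \<union> (S - A))) + card S
    \<le> card (nbrs_in G A D) + card (S - A - D) + card A"
proof -
  let ?N = "nbrs_in G A" and ?T = "S - A"
  have fin: "finite S" "finite A" "\<And>X. finite (?N X)"
    using A S by (auto intro: stable_set_finite finite_subset[OF nbrs_in_subset])
  have "card (?N (D \<union> ?T)) + card (?N (?T \<inter> D))
      \<le> card (?N D \<union> ?N ?T) + card (?N D \<inter> ?N ?T)"
    using fin unfolding nbrs_in_Un by (intro add_mono card_mono Int_greatest nbrs_in_mono) auto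
  also have "\<dots> = card (?N D) + card (?N ?T)"
    using fin by (simp add: card_Un_Int[symmetric])
  finally have "card (?N (D \<union> ?T)) + card (?N (?T \<inter> D)) \<le> card (?N D) + card (?N ?T)" .
  moreover have "card (?T \<inter> D) \<le> card (?N (?T \<inter> D))"
    using A S by (intro card_le_nbrs_in_maximum_stable) (auto intro: stable_set_subset)
  moreover have "card (?N ?T) \<le> card (?N S)"
    using fin by (intro card_mono nbrs_in_mono) auto
  moreover have "card (?N S) + card (S \<inter> A) \<le> card A"
    using fin S by (intro card_nbrs_in_stable_le)
  moreover have "card S = card (S \<inter> A) + card ?T"
    using fin by (simp add: card_Int_Diff)
  moreover have "card ?T = card (?T \<inter> D) + card (?T - D)"
    using fin by (simp add: card_Int_Diff)
  ultimately show ?thesis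
    by linarith
qed

text \<open>Here \<open>k\<close> stands for 1 + \<alpha> - \<sigma>; the additive form of the
  hypothesis avoids truncated subtraction.\<close>

lemma card_nbrs_in_le_mult:
  assumes A: "stable_set G A" "card A = stability_number G"
    and C: "finite C" "C \<inter> A = {}" "verts G \<subseteq> C \<union> A"
    and k: "\<And>v. v \<in> C \<Longrightarrow> \<exists>S. stable_set G S \<and> v \<in> S \<and> card A + 1 \<le> card S + k"
  shows "card (nbrs_in G A C) \<le> card C * k"
proof -
  let ?P = "\<lambda>D. D \<subseteq> C \<and> card (nbrs_in G A D) \<le> card D * k"
  have "finite {D. ?P D}" "{} \<in> {D. ?P D}"
    using C(1) by (auto simp: nbrs_in_def intro: finite_subset[of _ "Pow C"])
  \<comment> \<open>An inclusion-maximal \<open>D\<close> replaces the growing process: if it missed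
    a vertex of \<open>C\<close>, a stable set through that vertex would enlarge it.\<close>
  from finite_has_maximal2[OF this] obtain D
    where D: "?P D" and max: "\<And>E. ?P E \<Longrightarrow> D \<subseteq> E \<Longrightarrow> D = E"
    by auto
  have "D = C"
  proof (rule ccontr)
    assume "D \<noteq> C"
    with D obtain v where v: "v \<in> C" "v \<notin> D"
      by blast
    from k[OF v(1)] obtain S where S: "stable_set G S" "v \<in> S" "card A + 1 \<le> card S + k"
      by blast
    let ?E = "S - A - D"
    have fin: "finite D" "finite ?E"
      using D C(1) S(1) by (auto intro: finite_subset stable_set_finite)
    have vE: "v \<in> ?E"
      using v S(2) C(2) by blast
    have DE: "D \<union> (S - A) \<subseteq> C"
      using D S(1) C(3) by (auto simp: stable_set_def)
    have "1 \<le> card ?E"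
      using vE fin by (metis One_nat_def Suc_leI card_gt_0_iff empty_iff)
    moreover have "1 \<le> k"
      using S card_le_stability_number[OF S(1)] A(2) by linarith
    \<comment> \<open>\<open>(card ?E - 1) * (k - 1) \<ge> 0\<close>\<close>
    ultimately have ineq: "card ?E + k \<le> card ?E * k + 1"
      by (cases "card ?E"; cases k) auto
    have "card (nbrs_in G A (D \<union> (S - A))) + card S
        \<le> card (nbrs_in G A D) + card ?E + card A"
      using A S(1) D C(2) fin by (intro card_nbrs_in_Un_stable) auto
    \<comment> \<open>The increase is at most \<open>card ?E + k - 1\<close>, because
      \<open>card A - card S\<close> is at most \<open>k - 1\<close>; \<open>ineq\<close> turns this
      into the product.\<close>
    with S(3) ineq D have "card (nbrs_in G A (D \<union> (S - A))) \<le> card D * k + card ?E * k"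
      by linarith
    also have "\<dots> = card (D \<union> ?E) * k"
      using fin by (subst card_Un_disjoint) (auto simp: algebra_simps)
    also have "D \<union> ?E = D \<union> (S - A)"
      by blast
    finally have "?P (D \<union> (S - A))"
      using DE by blast
    from max[OF this] vE show False
      by blast
  qed
  with D show ?thesis
    by blast
qed

text \<open>The maximum defining \<open>sigma_v\<close> is attained: the vertex \<open>v\<close>
  bounds all admissible values by the stability number, and 0 is admissible because every singleton
  extends to a maximal stable set.\<close>

lemma sigma_v_witness:
  assumes "v \<in> verts G"
  obtains S where "maximal_stable_set G S" "v \<in> S" "sigma_v G \<le> card S"
proof -
  let ?M = "{m. \<forall>v \<in> verts G. \<exists>S. maximal_stable_set G S \<and> v \<in> S \<and> m \<le> card S}"
  have "?M \<subseteq> {..stability_number G}"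
  proof
    fix m assume "m \<in> ?M"
    with assms obtain S where "maximal_stable_set G S" "m \<le> card S"
      by blast
    then show "m \<in> {..stability_number G}"
      using card_le_stability_number[of S] by (simp add: maximal_stable_set_def)
  qed
  then have fin: "finite ?M"
    using finite_subset by blast
  have "0 \<in> ?M"
  proof clarify
    fix u assume u: "u \<in> verts G"
    let ?F = "{S. stable_set G S}"
    have "finite ?F"
      by (rule finite_subset[of _ "Pow (verts G)"]) (auto simp: stable_set_def)
    moreover have "{u} \<in> ?F"
      using u adj_not_same by (auto simp: stable_set_def)
    ultimately obtain S where "S \<in> ?F" "{u} \<subseteq> S" "\<forall>T \<in> ?F. S \<subseteq> T \<longrightarrow> S = T"
      using finite_has_maximal2[of ?F "{u}"] by blast
    then show "\<exists>S. maximal_stable_set G S \<and> u \<in> S \<and> 0 \<le> card S"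
      by (auto simp: maximal_stable_set_def)
  qed
  then have "sigma_v G \<in> ?M"
    unfolding sigma_v_def using Max_in[OF fin] by blast
  with assms that show thesis
    by blast
qed

end

theorem theorem2p1:
  fixes G :: "('a, 'b) pre_digraph"
  assumes "graph G"
    and "\<And>v. \<not> isolated_vertex G v"
  shows "int (stability_number G)
           \<le> int (vertex_cover_number G) * (1 + int (stability_number G) - int (sigma_v G))"
proof -
  interpret graph G by fact
  let ?\<alpha> = "stability_number G" and ?\<sigma> = "sigma_v G"
  obtain C where C: "vertex_cover G C" "card C = vertex_cover_number G"
    by (rule obtain_minimum_vertex_cover)
  define A where "A = verts G - C"
  have A: "stable_set G A" "card A = ?\<alpha>"
    using stable_set_Compl_cover[OF C(1)] stability_number_Compl_minimum_cover[OF C]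
    by (simp_all add: A_def)
  show ?thesis
  proof (cases "verts G = {}")
    \<comment> \<open>Here \<open>sigma_v\<close> is unspecified, but \<alpha> and the cover number
      are both 0, so both sides vanish.\<close>
    case True
    with A C show ?thesis
      by (simp add: A_def vertex_cover_def)
  next
    case False
    then obtain v where "v \<in> verts G"
      by blast
    then obtain S where "maximal_stable_set G S" "?\<sigma> \<le> card S"
      by (rule sigma_v_witness)
    \<comment> \<open>This keeps the natural-number subtraction below from truncating, so that it
      agrees with the integer one in the claim.\<close>
    then have \<sigma>: "?\<sigma> \<le> ?\<alpha>"
      using card_le_stability_number[of S] by (simp add: maximal_stable_set_def)
    have sub: "C \<subseteq> verts G"
      using C(1) by (simp add: vertex_cover_def)
    \<comment> \<open>Each vertex of \<open>A\<close> has a neighbour, as none is isolated, and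
      stability of \<open>A\<close> forces that neighbour into \<open>C\<close>.\<close>
    have "A \<subseteq> nbrs_in G A C"
    proof
      fix a assume a: "a \<in> A"
      then obtain u where u: "u \<in> verts G" "a \<rightarrow>\<^bsub>G\<^esub> u"
        using assms(2)[of a] by (auto simp: isolated_vertex_def A_def)
      with a A(1) have "u \<in> C"
        by (auto simp: stable_set_def A_def)
      with a arcs_ends_symmetric[OF sym_arcs u(2)] show "a \<in> nbrs_in G A C"
        by (auto simp: nbrs_in_def)
    qed
    then have "nbrs_in G A C = A"
      by (rule antisym[OF nbrs_in_subset])
    moreover have "card (nbrs_in G A C) \<le> card C * (1 + ?\<alpha> - ?\<sigma>)"
    proof (rule card_nbrs_in_le_mult[OF A])
      show "finite C" "C \<inter> A = {}" "verts G \<subseteq> C \<union> A"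
        using sub by (auto simp: A_def intro: finite_subset[OF _ finite_verts])
      fix v assume "v \<in> C"
      with sub obtain S where "maximal_stable_set G S" "v \<in> S" "?\<sigma> \<le> card S"
        using sigma_v_witness by blast
      then show "\<exists>S. stable_set G S \<and> v \<in> S \<and> card A + 1 \<le> card S + (1 + ?\<alpha> - ?\<sigma>)"
        using A(2) \<sigma> by (intro exI[of _ S]) (auto simp: maximal_stable_set_def)
    qed
    ultimately have "?\<alpha> \<le> vertex_cover_number G * (1 + ?\<alpha> - ?\<sigma>)"
      using A(2) C(2) by simp
    then have "int ?\<alpha> \<le> int (vertex_cover_number G * (1 + ?\<alpha> - ?\<sigma>))"
      by (simp only: of_nat_le_iff)
    also have "\<dots> = int (vertex_cover_number G) * (1 + int ?\<alpha> - int ?\<sigma>)"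
      using \<sigma> by (simp add: of_nat_diff)
    finally show ?thesis .
  qed
qed

end
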